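(* (a) Assume $\mathcal{F} = \{f_i\}_{i \in I}$ is a frame for $H$ and $\mathcal{E} = \{e_j\}_{j \in G}$ is a Riesz sequence in $H$. Let $a \colon I \to G$ be a map. If $(\mathcal{F},a,\mathcal{E})$ has the weak HAP, then $1 \le D^-(I,a) \le D^+(I,a) \le \infty$. (b) Assume $\mathcal{F} = \{f_i\}_{i \in I}$ is a Riesz sequence in $H$ and $\mathcal{E} = \{e_j\}_{j \in G}$ is a frame for $H$. Let $a \colon I \to G$ be a map. If $(\mathcal{F},a,\mathcal{E})$ has the weak dual HAP, then $0 \le D^-(I,a) \le D^+(I,a) \le 1$.
   Context: $H$ is a separable Hilbert space and $I$ is a countable index set. $G = \prod_{i=1}^d a_i \mathbf{Z} \times \prod_{j=1}^e \mathbf{Z}_{n_j}$ (with $d \ge 1$, $a_i>0$, a countably infinite abelian group), equipped with $|g| = \sup\{|a_1 k_1|,\dots,|a_d k_d|,\delta(m_1),\dots,\delta(m_e)\}$ for $g=(a_1k_1,\dots,a_dk_d,m_1,\dots,m_e)$, where $\delta(0)=0$ and $\delta(m)=1$ for $m\neq 0$. For $N \in \mathbf{N}$ and $j\in G$ put $S_N(j) = \{k \in G : |k-j| \le N/2\}$ and $I_N(j) = a^{-1}(S_N(j))$. The lower and upper densities (values in $[0,\infty]$) are $D^-(I,a) = \liminf_{N\to\infty} \inf_{j\in G} |I_N(j)|/|S_N(j)|$ and $D^+(I,a) = \limsup_{N\to\infty} \sup_{j\in G} |I_N(j)|/|S_N(j)|$. A Riesz sequence is a Riesz basis for its closed linear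 span. The canonical dual of a frame $\{g_i\}$ for $H$ with frame operator $S$ (i.e. $Sf=\sum_i\langle f,g_i\rangle g_i$) is $\{\tilde g_i\}$ with $\tilde g_i = S^{-1}g_i$. Weak HAP (for $\mathcal{F}$ a frame for $H$ with canonical dual $\{\tilde f_i\}$ and $\mathcal{E}$ a sequence in $H$): for every $\varepsilon>0$ there is an integer $N_\varepsilon>0$ such that for every $j\in G$, $\mathrm{dist}\bigl(e_j, \overline{\mathrm{span}}\{\tilde f_i : i\in I_{N_\varepsilon}(j)\}\bigr)<\varepsilon$. Weak dual HAP (for $\mathcal{F}$ a sequence in $H$ and $\mathcal{E}$ a frame for $H$ with canonical dual $\{\tilde e_j\}$): for every $\varepsilon>0$ there is an integer $N_\varepsilon>0$ such that for every $i\in I$, $\mathrm{dist}\bigl(f_i, \overline{\mathrm{span}}\{\tilde e_j : j\in S_{N_\varepsilon}(a(i))\}\bigr)<\varepsilon$. *)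

theory Defs
  imports "HOL-Analysis.Analysis" "HOL-Algebra.Product_Groups"
begin

section \<open>Hilbert spaces over the real or complex scalars\<close>

text \<open>
  The scalar field is \<open>\<real>\<close> or \<open>\<complex>\<close>. By the second axiom \<open>conjg x = (norm x)\<^sup>2 / x\<close> for \<open>x \<noteq> 0\<close>;
  comparing \<open>(1 + x) * conjg (1 + x)\<close> with its value shows that \<open>x + conjg x\<close> is real as well. So
  every scalar is a root of a real quadratic polynomial, and up to isomorphism the only instances
  are \<open>\<real>\<close> and \<open>\<complex>\<close> with the usual conjugation.
\<close>

class real_or_complex = real_normed_field +
  fixes conjg :: "'a \<Rightarrow> 'a"
  assumes conjg_add: "conjg (x + y) = conjg x + conjg y"
    and mult_conjg: "x * conjg x = (norm x)\<^sup>2 *\<^sub>R 1"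

instantiation real :: real_or_complex
begin
definition conjg_real :: "real \<Rightarrow> real" where "conjg_real x = x"
instance by standard (simp_all add: conjg_real_def power2_eq_square)
end

instantiation complex :: real_or_complex
begin
definition conjg_complex :: "complex \<Rightarrow> complex" where "conjg_complex = cnj"
instance
  by standard (simp_all add: conjg_complex_def scaleR_conv_of_real complex_norm_square del: of_real_power)
end

text \<open>
  The inner product \<open>ip\<close> is linear in the first argument. Completeness is part of the class
  \<open>banach\<close>, and norm and topology of the type are those of \<open>ip\<close>.
\<close>

locale separable_hilbert_space = vector_space smul
  for smul :: "'k::real_or_complex \<Rightarrow> 'h::banach \<Rightarrow> 'h" +
  fixes ip :: "'h \<Rightarrow> 'h \<Rightarrow> 'k"
  assumes scale_of_real: "smul (of_real r) x = r *\<^sub>R x"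
    and ip_add_left: "ip (x + y) z = ip x z + ip y z"
    and ip_scale_left: "ip (smul c x) z = c * ip x z"
    and ip_commute: "ip y x = conjg (ip x y)"
    and ip_self: "ip x x = of_real ((norm x)\<^sup>2)"
    and separable: "separable_space (euclidean :: 'h topology)"

lemma separable_hilbert_space_real:
  assumes "separable_space (euclidean :: 'h::{real_inner,banach} topology)"
  shows "separable_hilbert_space ((*\<^sub>R) :: real \<Rightarrow> 'h \<Rightarrow> 'h) inner"
  using assms
  by unfold_locales
    (auto simp: scaleR_add_left scaleR_add_right inner_add_left conjg_real_def dot_square_norm
      intro: inner_commute)

lemma separable_hilbert_space_complex:
  "separable_hilbert_space ((*) :: complex \<Rightarrow> complex \<Rightarrow> complex) (\<lambda>x y. x * cnj y)"
proof -
  obtain D :: "complex set" where "countable D" "\<And>X. open X \<Longrightarrow> X \<noteq> {} \<Longrightarrow> \<exists>d\<in>D. d \<in> X"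
    using countable_dense_setE by blast
  then have "closure D = UNIV"
    using closure_subset[of D]
    by (metis ComplD Compl_empty_eq double_compl open_Compl closed_closure subsetD)
  with \<open>countable D\<close> have "separable_space (euclidean :: complex topology)"
    unfolding separable_space_def by (intro exI[of _ D]) simp
  then show ?thesis
    by unfold_locales
      (simp_all add: distrib_left distrib_right mult.assoc scaleR_conv_of_real conjg_complex_def
        mult.commute complex_norm_square del: of_real_power)
qed

section \<open>Frames and Riesz sequences\<close>

definition closed_span :: "('k::real_or_complex \<Rightarrow> 'h::banach \<Rightarrow> 'h) \<Rightarrow> 'h set \<Rightarrow> 'h set"
  where "closed_span smul X = closure (module.span smul X)"

definition is_frame :: "('h::banach \<Rightarrow> 'h \<Rightarrow> 'k::real_or_complex) \<Rightarrow> 'i set \<Rightarrow> ('i \<Rightarrow> 'h) \<Rightarrow> bool"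
  where "is_frame ip I g \<longleftrightarrow>
    (\<exists>A>0. \<exists>B>0. \<forall>f. (\<lambda>i. (norm (ip f (g i)))\<^sup>2) summable_on I \<and>
       A * (norm f)\<^sup>2 \<le> (\<Sum>\<^sub>\<infinity>i\<in>I. (norm (ip f (g i)))\<^sup>2) \<and>
       (\<Sum>\<^sub>\<infinity>i\<in>I. (norm (ip f (g i)))\<^sup>2) \<le> B * (norm f)\<^sup>2)"

definition frame_operator ::
  "('k::real_or_complex \<Rightarrow> 'h::banach \<Rightarrow> 'h) \<Rightarrow> ('h \<Rightarrow> 'h \<Rightarrow> 'k) \<Rightarrow> 'i set \<Rightarrow> ('i \<Rightarrow> 'h) \<Rightarrow> 'h \<Rightarrow> 'h"
  where "frame_operator smul ip I g f = (\<Sum>\<^sub>\<infinity>i\<in>I. smul (ip f (g i)) (g i))"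

definition canonical_dual ::
  "('k::real_or_complex \<Rightarrow> 'h::banach \<Rightarrow> 'h) \<Rightarrow> ('h \<Rightarrow> 'h \<Rightarrow> 'k) \<Rightarrow> 'i set \<Rightarrow> ('i \<Rightarrow> 'h) \<Rightarrow> 'i \<Rightarrow> 'h"
  where "canonical_dual smul ip I g i = inv_into UNIV (frame_operator smul ip I g) (g i)"

definition orthonormal_basis_of ::
  "('k::real_or_complex \<Rightarrow> 'h::banach \<Rightarrow> 'h) \<Rightarrow> ('h \<Rightarrow> 'h \<Rightarrow> 'k) \<Rightarrow> 'h set \<Rightarrow> 'i set \<Rightarrow> ('i \<Rightarrow> 'h) \<Rightarrow> bool"
  where "orthonormal_basis_of smul ip K I u \<longleftrightarrow>
    (\<forall>i\<in>I. \<forall>j\<in>I. ip (u i) (u j) = (if i = j then 1 else 0)) \<and> closed_span smul (u ` I) = K"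

text \<open>
  A Riesz basis of a closed subspace \<open>K\<close> is the image of an orthonormal basis of \<open>K\<close> under a
  topological isomorphism (linear homeomorphism) of \<open>K\<close> onto itself.
\<close>

definition riesz_basis_of ::
  "('k::real_or_complex \<Rightarrow> 'h::banach \<Rightarrow> 'h) \<Rightarrow> ('h \<Rightarrow> 'h \<Rightarrow> 'k) \<Rightarrow> 'h set \<Rightarrow> 'i set \<Rightarrow> ('i \<Rightarrow> 'h) \<Rightarrow> bool"
  where "riesz_basis_of smul ip K I g \<longleftrightarrow>
    (\<exists>u T T'. orthonormal_basis_of smul ip K I u \<and>
       (\<forall>x\<in>K. \<forall>y\<in>K. T (x + y) = T x + T y) \<and> (\<forall>c. \<forall>x\<in>K. T (smul c x) = smul c (T x)) \<and>
       homeomorphism K K T T' \<and> (\<forall>i\<in>I. g i = T (u i)))"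

definition riesz_sequence ::
  "('k::real_or_complex \<Rightarrow> 'h::banach \<Rightarrow> 'h) \<Rightarrow> ('h \<Rightarrow> 'h \<Rightarrow> 'k) \<Rightarrow> 'i set \<Rightarrow> ('i \<Rightarrow> 'h) \<Rightarrow> bool"
  where "riesz_sequence smul ip I g \<longleftrightarrow> riesz_basis_of smul ip (closed_span smul (g ` I)) I g"

section \<open>The index group\<close>

definition scaled_integer_group :: "real \<Rightarrow> real monoid"
  where "scaled_integer_group \<alpha> =
    \<lparr>carrier = range (\<lambda>k::int. \<alpha> * of_int k), monoid.mult = (+), one = 0\<rparr>"

type_synonym index = "(nat \<Rightarrow> real) \<times> (nat \<Rightarrow> int)"

definition index_group :: "nat \<Rightarrow> (nat \<Rightarrow> real) \<Rightarrow> nat \<Rightarrow> (nat \<Rightarrow> nat) \<Rightarrow> index monoid"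
  where "index_group d \<alpha> e n =
    product_group {..<d} (\<lambda>i. scaled_integer_group (\<alpha> i)) \<times>\<times>
    product_group {..<e} (\<lambda>j. integer_mod_group (n j))"

lemma comm_group_scaled_integer_group: "comm_group (scaled_integer_group \<alpha>)"
proof (rule comm_groupI)
  fix x y assume "x \<in> carrier (scaled_integer_group \<alpha>)" "y \<in> carrier (scaled_integer_group \<alpha>)"
  then obtain k l :: int where "x = \<alpha> * of_int k" "y = \<alpha> * of_int l"
    by (auto simp: scaled_integer_group_def)
  then have "x + y \<in> range (\<lambda>k::int. \<alpha> * of_int k)"
    by (intro range_eqI[of _ _ "k + l"]) (simp add: distrib_left)
  then show "x \<otimes>\<^bsub>scaled_integer_group \<alpha>\<^esub> y \<in> carrier (scaled_integer_group \<alpha>)"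
    by (simp add: scaled_integer_group_def)
next
  fix x assume "x \<in> carrier (scaled_integer_group \<alpha>)"
  then obtain k :: int where "x = \<alpha> * of_int k"
    by (auto simp: scaled_integer_group_def)
  then have "- x \<in> range (\<lambda>k::int. \<alpha> * of_int k)"
    by (intro range_eqI[of _ _ "- k"]) simp
  then have "- x \<in> carrier (scaled_integer_group \<alpha>)"
    by (simp add: scaled_integer_group_def)
  then show "\<exists>y\<in>carrier (scaled_integer_group \<alpha>).
      y \<otimes>\<^bsub>scaled_integer_group \<alpha>\<^esub> x = \<one>\<^bsub>scaled_integer_group \<alpha>\<^esub>"
    by (rule bexI[rotated]) (simp add: scaled_integer_group_def)
qed (auto simp: scaled_integer_group_def image_iff intro: exI[of _ 0])

lemma group_index_group: "group (index_group d \<alpha> e n)"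
  unfolding index_group_def
  by (intro DirProd_group)
    (simp_all add: comm_group.axioms(2)[OF comm_group_scaled_integer_group])

text \<open>In \<^const>\<open>integer_mod_group\<close> the residue classes are represented by \<open>0, \<dots>, n - 1\<close>.\<close>

definition index_abs :: "nat \<Rightarrow> nat \<Rightarrow> index \<Rightarrow> real"
  where "index_abs d e = (\<lambda>(x, m).
    Sup ((\<lambda>i. \<bar>x i\<bar>) ` {..<d} \<union> (\<lambda>j. if m j = 0 then 0 else 1) ` {..<e}))"

section \<open>Boxes, densities and approximation properties\<close>

text \<open>
  Here \<open>G\<close> is the index group and \<open>\<nu>\<close> the function \<open>g \<mapsto> \<bar>g\<bar>\<close> on it; the difference \<open>k - j\<close> is
  written multiplicatively.
\<close>

definition lattice_box :: "'g monoid \<Rightarrow> ('g \<Rightarrow> real) \<Rightarrow> nat \<Rightarrow> 'g \<Rightarrow> 'g set"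
  where "lattice_box G \<nu> N j = {k \<in> carrier G. \<nu> (k \<otimes>\<^bsub>G\<^esub> inv\<^bsub>G\<^esub> j) \<le> real N / 2}"

definition preimage_box ::
  "'g monoid \<Rightarrow> ('g \<Rightarrow> real) \<Rightarrow> 'i set \<Rightarrow> ('i \<Rightarrow> 'g) \<Rightarrow> nat \<Rightarrow> 'g \<Rightarrow> 'i set"
  where "preimage_box G \<nu> I a N j = {i \<in> I. a i \<in> lattice_box G \<nu> N j}"

definition ecard :: "'a set \<Rightarrow> ennreal"
  where "ecard X = (if finite X then of_nat (card X) else \<infinity>)"

definition lower_density :: "'g monoid \<Rightarrow> ('g \<Rightarrow> real) \<Rightarrow> 'i set \<Rightarrow> ('i \<Rightarrow> 'g) \<Rightarrow> ennreal"
  where "lower_density G \<nu> I a =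
    liminf (\<lambda>N. INF j\<in>carrier G. ecard (preimage_box G \<nu> I a N j) / ecard (lattice_box G \<nu> N j))"

definition upper_density :: "'g monoid \<Rightarrow> ('g \<Rightarrow> real) \<Rightarrow> 'i set \<Rightarrow> ('i \<Rightarrow> 'g) \<Rightarrow> ennreal"
  where "upper_density G \<nu> I a =
    limsup (\<lambda>N. SUP j\<in>carrier G. ecard (preimage_box G \<nu> I a N j) / ecard (lattice_box G \<nu> N j))"

definition weak_HAP ::
  "('k::real_or_complex \<Rightarrow> 'h::banach \<Rightarrow> 'h) \<Rightarrow> ('h \<Rightarrow> 'h \<Rightarrow> 'k) \<Rightarrow> 'g monoid \<Rightarrow> ('g \<Rightarrow> real) \<Rightarrow>
    'i set \<Rightarrow> ('i \<Rightarrow> 'h) \<Rightarrow> ('i \<Rightarrow> 'g) \<Rightarrow> ('g \<Rightarrow> 'h) \<Rightarrow> bool"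
  where "weak_HAP smul ip G \<nu> I F a E \<longleftrightarrow>
    (\<forall>\<epsilon>>0. \<exists>N>0. \<forall>j\<in>carrier G.
      infdist (E j) (closed_span smul (canonical_dual smul ip I F ` preimage_box G \<nu> I a N j)) < \<epsilon>)"

definition weak_dual_HAP ::
  "('k::real_or_complex \<Rightarrow> 'h::banach \<Rightarrow> 'h) \<Rightarrow> ('h \<Rightarrow> 'h \<Rightarrow> 'k) \<Rightarrow> 'g monoid \<Rightarrow> ('g \<Rightarrow> real) \<Rightarrow>
    'i set \<Rightarrow> ('i \<Rightarrow> 'h) \<Rightarrow> ('i \<Rightarrow> 'g) \<Rightarrow> ('g \<Rightarrow> 'h) \<Rightarrow> bool"
  where "weak_dual_HAP smul ip G \<nu> I F a E \<longleftrightarrow>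
    (\<forall>\<epsilon>>0. \<exists>N>0. \<forall>i\<in>I.
      infdist (F i) (closed_span smul (canonical_dual smul ip (carrier G) E ` lattice_box G \<nu> N (a i))) < \<epsilon>)"

end

theory Submission
  imports Defs "HOL-Real_Asymp.Real_Asymp"
begin

text \<open>
  Both parts are one dimension count. A Riesz sequence \<open>g\<close> is uniformly minimal: every \<open>g j\<close> has distance at
  least some fixed \<open>\<delta> > 0\<close> from the span of the others (\<open>riesz_sequence_uniformly_minimal\<close>). If finitely many
  \<open>g j\<close>, \<open>j \<in> J\<close>, all lie within \<open>\<epsilon>\<close> of the span of a finite set \<open>X\<close>, comparing two expressions for the trace
  of a product of two orthogonal projections gives \<open>(1 - \<epsilon> / \<delta>) * card J \<le> card X\<close>
  (\<open>card_le_dimension_of_approximating_span\<close>). The essential point is that the relative loss \<open>\<epsilon> / \<delta>\<close> does not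
  depend on \<open>card J\<close>.

  In part (a) the Riesz sequence is \<open>E\<close> and \<open>J\<close> is the box of size \<open>N\<close> around \<open>j\<close>. By the approximation
  property with box size \<open>M\<close>, the vectors \<open>E k\<close> for \<open>k \<in> J\<close> are close to spans of dual frame vectors whose
  indices are mapped into the box of size \<open>N + M\<close> around \<open>j\<close>. Hence the preimage of that larger box has at least
  \<open>(1 - \<eta>) * card J\<close> elements. In part (b) the roles are exchanged: the finite subsets of the preimage of the box
  of size \<open>N\<close> index vectors close to a span of dual vectors indexed by the box of size \<open>N + M\<close>.

  It remains that \<open>N\<close> and \<open>N + M\<close> give asymptotically the same number of lattice points. All boxes of one size
  are translates of each other, so this is a single limit (\<open>amenable_length_index_group\<close>): the number of
  lattice points is a product of \<open>d\<close> factors \<open>2 * \<lfloor>N / (2 * \<alpha> i)\<rfloor> + 1\<close> and, for \<open>N \<ge> 2\<close>, of the constant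
  orders of the cyclic factors. The two passages to the limit are \<open>lower_density_ge_one\<close> and
  \<open>upper_density_le_one\<close>.
\<close>

section \<open>Inner products and orthogonal projections\<close>

text \<open>
The second axiom gives \<open>conjg x = (norm x)\<^sup>2 / x\<close> for \<open>x \<noteq> 0\<close>, so multiplicativity of the conjugation
and its triviality on real scalars follow by cancelling. These are what sesquilinearity of \<open>ip\<close> in the
second argument rests on.
\<close>

lemma conjg_zero: "conjg (0::'k::real_or_complex) = 0"
  using conjg_add[of "0::'k" 0] by simp

lemma conjg_mult: "conjg (x * y) = conjg x * conjg (y::'k::real_or_complex)"
proof (cases "x * y = 0")
  case True
  then show ?thesis by (auto simp: conjg_zero)
next
  case False
  have "(x * y) * conjg (x * y) = (x * conjg x) * (y * conjg y)"
    by (simp add: mult_conjg norm_mult power_mult_distrib)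
  also have "\<dots> = (x * y) * (conjg x * conjg y)"
    by (simp only: mult_ac)
  finally show ?thesis using False by (metis mult_left_cancel)
qed

lemma conjg_of_real: "conjg (of_real r :: 'k::real_or_complex) = of_real r"
proof (cases "r = 0")
  case False
  have "of_real r * conjg (of_real r :: 'k) = of_real r * of_real r"
    by (simp add: mult_conjg scaleR_conv_of_real power2_eq_square)
  then show ?thesis using False by simp
qed (simp add: conjg_zero)

context separable_hilbert_space
begin

lemma ip_zero_left [simp]: "ip 0 y = 0"
  using ip_add_left[of 0 0 y] by simp

lemma ip_diff_left: "ip (x - y) z = ip x z - ip y z"
  using ip_add_left[of "x - y" y z] by simp

lemma ip_sum_left: "ip (\<Sum>i\<in>A. f i) z = (\<Sum>i\<in>A. ip (f i) z)"
  by (induction A rule: infinite_finite_induct) (auto simp: ip_add_left)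

lemma ip_add_right: "ip x (y + z) = ip x y + ip x z"
  by (metis ip_commute ip_add_left conjg_add)

lemma ip_scale_right: "ip x (smul c y) = conjg c * ip x y"
  by (metis ip_commute ip_scale_left conjg_mult)

lemma ip_zero_right [simp]: "ip x 0 = 0"
  using ip_add_right[of x 0 0] by simp

lemma ip_eq_zero_commute: "ip x y = 0 \<Longrightarrow> ip y x = 0"
  by (metis ip_commute conjg_zero)

lemma norm_smul: "norm (smul c x) = norm c * norm x"
proof -
  have "of_real ((norm (smul c x))\<^sup>2) = (c * conjg c) * ip x x"
    by (simp only: ip_self[symmetric] ip_scale_left ip_scale_right mult_ac)
  also have "\<dots> = of_real ((norm c * norm x)\<^sup>2)"
    by (simp add: ip_self mult_conjg scaleR_conv_of_real power_mult_distrib)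
  finally show ?thesis
    by (metis of_real_eq_iff norm_ge_zero power2_eq_iff_nonneg mult_nonneg_nonneg)
qed

lemma pythagoras:
  assumes "ip x y = 0"
  shows "(norm (x + y))\<^sup>2 = (norm x)\<^sup>2 + (norm y)\<^sup>2"
proof -
  have "(of_real ((norm (x + y))\<^sup>2) :: 'k) = of_real ((norm x)\<^sup>2 + (norm y)\<^sup>2)"
    unfolding ip_self[symmetric] of_real_add
    by (simp add: ip_add_left ip_add_right assms ip_eq_zero_commute[OF assms])
  then show ?thesis by (simp only: of_real_eq_iff)
qed

lemma norm_le_if_orthogonal:
  assumes "ip x y = 0"
  shows "norm x \<le> norm (x + y)"
  using pythagoras[OF assms] by (simp add: power2_le_imp_le)

lemma Cauchy_Schwarz: "norm (ip x y) \<le> norm x * norm y"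
proof (cases "y = 0")
  case False
  define c where "c = ip x y / ip y y"
  have yy: "ip y y \<noteq> 0" using False by (simp add: ip_self)
  have "ip (x - smul c y) y = 0"
    using yy by (simp add: ip_diff_left ip_scale_left c_def)
  then have "ip (smul c y) (x - smul c y) = 0"
    by (simp add: ip_scale_left ip_eq_zero_commute)
  from norm_le_if_orthogonal[OF this] have "norm c * norm y \<le> norm x"
    by (simp add: norm_smul)
  moreover have "norm c = norm (ip x y) / (norm y)\<^sup>2"
    by (simp add: c_def norm_divide ip_self norm_power)
  ultimately show ?thesis
    using False by (simp add: field_simps power2_eq_square)
qed simp

lemma orthogonal_span:
  assumes "\<And>y. y \<in> X \<Longrightarrow> ip x y = 0" and "y \<in> span X"
  shows "ip x y = 0"
  using assms(2)
  by (induction rule: span_induct_alt) (auto simp: ip_add_right ip_scale_right assms(1))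

text \<open>
Orthonormality is stated for sets, so that the cardinality of an orthonormal basis can be compared
with that of an arbitrary spanning set.
\<close>

definition orthonormal :: "'h set \<Rightarrow> bool"
  where "orthonormal B \<longleftrightarrow> (\<forall>b\<in>B. \<forall>c\<in>B. ip b c = (if b = c then 1 else 0))"

lemma orthonormalD_norm:
  assumes "orthonormal B" "b \<in> B"
  shows "norm b = 1"
proof -
  have "of_real ((norm b)\<^sup>2) = (of_real 1 :: 'k)"
    using assms by (simp only: ip_self[symmetric]) (simp add: orthonormal_def)
  then have "(norm b)\<^sup>2 = 1" by (simp only: of_real_eq_iff)
  then show ?thesis by (simp add: power2_eq_1_iff) (metis norm_ge_zero not_one_le_zero neg_0_le_iff_le)
qed

lemma orthonormal_projection:
  assumes "finite B" "orthonormal B" "y \<in> span B"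
  shows "ip (x - (\<Sum>b\<in>B. smul (ip x b) b)) y = 0"
proof (rule orthogonal_span[OF _ assms(3)])
  fix c assume c: "c \<in> B"
  have "ip (\<Sum>b\<in>B. smul (ip x b) b) c = (\<Sum>b\<in>B. if b = c then ip x b else 0)"
    unfolding ip_sum_left
    using assms(2) c by (intro sum.cong) (auto simp: ip_scale_left orthonormal_def)
  also have "\<dots> = ip x c" using assms(1) c by simp
  finally show "ip (x - (\<Sum>b\<in>B. smul (ip x b) b)) c = 0"
    by (simp add: ip_diff_left)
qed

text \<open>
The bound on \<open>card B\<close> is what turns a trace over an orthonormal basis into a bound by the number of
spanning vectors; a vector that already lies in the span of its predecessors contributes nothing.
\<close>

lemma Gram_Schmidt:
  assumes "finite X"
  shows "\<exists>B. finite B \<and> card B \<le> card X \<and> orthonormal B \<and> span B = span X"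
  using assms
proof (induction X)
  case empty
  show ?case by (intro exI[of _ "{}"]) (auto simp: orthonormal_def)
next
  case (insert x X)
  then obtain B where B: "finite B" "card B \<le> card X" "orthonormal B" "span B = span X" by blast
  define p where "p = (\<Sum>b\<in>B. smul (ip x b) b)"
  define r where "r = x - p"
  have p: "p \<in> span B" unfolding p_def by (intro span_sum span_scale span_base)
  show ?case
  proof (cases "r = 0")
    case True
    then have "x \<in> span X" using p B(4) by (simp add: r_def)
    then have "span (insert x X) = span X" by (rule span_redundant)
    then show ?thesis using B insert by (intro exI[of _ B]) auto
  next
    case False
    define c where "c = smul (of_real (inverse (norm r))) r"
    have r: "ip r y = 0" if "y \<in> span B" for y
      using orthonormal_projection[OF B(1,3) that, of x] by (simp add: r_def p_def)
    have c0: "ip c b = 0" if "b \<in> B" for b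
      using r[OF span_base[OF that]] by (simp add: c_def ip_scale_left)
    have "norm c = 1" using False by (simp add: c_def norm_smul norm_inverse)
    then have "ip c c = 1" by (simp add: ip_self)
    then have on: "orthonormal (insert c B)"
      using B(3) c0 ip_eq_zero_commute[OF c0] by (auto simp: orthonormal_def)
    have p': "p \<in> span (insert y B)" for y
      using p span_mono[OF subset_insertI, of B y] by blast
    have "smul (of_real (norm r)) c = r"
      using False unfolding c_def scale_of_real by simp
    then have "x = smul (of_real (norm r)) c + p" by (simp add: r_def)
    moreover have "smul (of_real (norm r)) c + p \<in> span (insert c B)"
      by (intro span_add p' span_scale span_base insertI1)
    ultimately have x: "x \<in> span (insert c B)" by simp
    have c: "c \<in> span (insert x B)"
      unfolding c_def r_def by (intro span_scale span_diff p' span_base insertI1)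
    have "B \<subseteq> span (insert y B)" for y by (auto intro: span_base)
    then have "span (insert c B) = span (insert x B)"
      unfolding span_eq using x c by simp
    also have "\<dots> = span (insert x X)"
      unfolding span_insert B(4) ..
    finally show ?thesis
      using B(1,2) insert on by (intro exI[of _ "insert c B"]) (auto simp: card_insert_if)
  qed
qed

lemma orthogonal_projection_exists:
  assumes "finite X"
  obtains p where "p \<in> span X" and "\<And>y. y \<in> span X \<Longrightarrow> ip (x - p) y = 0"
proof -
  from Gram_Schmidt[OF assms] obtain B where B: "finite B" "orthonormal B" "span B = span X" by blast
  show thesis
  proof
    show "(\<Sum>b\<in>B. smul (ip x b) b) \<in> span X"
      unfolding B(3)[symmetric] by (intro span_sum span_scale span_base)
  qed (use orthonormal_projection[OF B(1,2)] B(3) in auto)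
qed

section \<open>Comparing dimensions by traces\<close>

text \<open>
The component of \<open>g j\<close> orthogonal to the other vectors, rescaled: its norm is the distance from \<open>g j\<close>
to their span, and the rescaling inverts this norm, whence the bound \<open>1 / \<delta>\<close>. The vector is
taken inside \<open>span (g ` J)\<close> because only then the expansion operator of the next lemma is an orthogonal
projection.
\<close>

lemma biorthogonal_vector_exists:
  assumes J: "finite J" "j \<in> J" and \<delta>: "\<delta> > 0"
    and sep: "\<And>w. w \<in> span (g ` (J - {j})) \<Longrightarrow> \<delta> \<le> norm (g j - w)"
  shows "\<exists>h. h \<in> span (g ` J) \<and> norm h \<le> 1 / \<delta> \<and> (\<forall>k\<in>J. ip (g k) h = (if k = j then 1 else 0))"
proof -
  have "finite (g ` (J - {j}))" using J by simp
  from orthogonal_projection_exists[OF this, of "g j"]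
  obtain p where p: "p \<in> span (g ` (J - {j}))"
    and orth: "\<And>y. y \<in> span (g ` (J - {j})) \<Longrightarrow> ip (g j - p) y = 0" by blast
  define r where "r = g j - p"
  define h where "h = smul (of_real (inverse ((norm r)\<^sup>2))) r"
  have r: "\<delta> \<le> norm r" using sep[OF p] by (simp add: r_def)
  then have r0: "norm r \<noteq> 0" using \<delta> by linarith
  have "norm h = inverse (norm r)"
    unfolding h_def norm_smul norm_of_real using r0 by (simp add: field_simps power2_eq_square)
  also have "\<dots> \<le> 1 / \<delta>" using r \<delta> by (simp add: divide_inverse le_imp_inverse_le)
  finally have 1: "norm h \<le> 1 / \<delta>" .
  have "p \<in> span (g ` J)" using p span_mono[of "g ` (J - {j})" "g ` J"] by blast
  then have 2: "h \<in> span (g ` J)"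
    unfolding h_def r_def using J span_base[of "g j" "g ` J"] by (intro span_scale span_diff) auto
  have "ip (g k) h = (if k = j then 1 else 0)" if "k \<in> J" for k
  proof (cases "k = j")
    case True
    have "ip (g j) r = ip r r"
      using ip_add_left[of r p r] ip_eq_zero_commute[OF orth[OF p]] by (simp add: r_def)
    then show ?thesis
      using True r0 by (simp add: h_def ip_scale_right conjg_of_real ip_self
        flip: of_real_mult of_real_inverse of_real_power)
  next
    case False
    then have "ip r (g k) = 0" using that orth by (simp add: r_def span_base)
    then show ?thesis using False by (simp add: h_def ip_scale_right ip_eq_zero_commute)
  qed
  with 1 2 show ?thesis by blast
qed

text \<open>
A trace comparison. Let \<open>P\<close> be the orthogonal projection onto \<open>span X\<close>, let \<open>h j\<close> be the vectors biorthogonal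
to \<open>g j\<close>, and let \<open>t = (\<Sum>j\<in>J. ip (P (g j)) (h j))\<close>, the trace of \<open>P\<close> compressed to \<open>span (g ` J)\<close>. Every
summand is within \<open>\<epsilon> / \<delta>\<close> of \<open>ip (g j) (h j) = 1\<close>, so \<open>t\<close> is close to \<open>card J\<close>. Expanding \<open>P\<close> in an
orthonormal basis \<open>B\<close> of \<open>span X\<close> and exchanging the sums, the same number is \<open>(\<Sum>b\<in>B. ip (Q b) b)\<close> with
\<open>Q\<close> the orthogonal projection onto \<open>span (g ` J)\<close>, so it is at most \<open>card B \<le> card X\<close>. The error per vector
stays constant, however large \<open>J\<close> is; a perturbation argument for linear independence would lose a factor
growing with \<open>card J\<close>.
\<close>

lemma card_le_dimension_of_approximating_span:
  fixes g :: "'j \<Rightarrow> 'h" and X :: "'h set"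
  assumes J: "finite J" and X: "finite X" and \<delta>: "\<delta> > 0"
    and sep: "\<And>j w. j \<in> J \<Longrightarrow> w \<in> span (g ` (J - {j})) \<Longrightarrow> \<delta> \<le> norm (g j - w)"
    and approx: "\<And>j. j \<in> J \<Longrightarrow> \<exists>v\<in>span X. norm (g j - v) \<le> \<epsilon>"
  shows "(1 - \<epsilon> / \<delta>) * real (card J) \<le> real (card X)"
proof -
  from Gram_Schmidt[OF X] obtain B where B: "finite B" "card B \<le> card X" "orthonormal B" "span B = span X"
    by blast
  have "\<forall>j\<in>J. \<exists>h. h \<in> span (g ` J) \<and> norm h \<le> 1 / \<delta> \<and> (\<forall>k\<in>J. ip (g k) h = (if k = j then 1 else 0))"
    using biorthogonal_vector_exists[OF J _ \<delta>] sep by blast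
  then obtain h where h: "\<And>j. j \<in> J \<Longrightarrow> h j \<in> span (g ` J)" "\<And>j. j \<in> J \<Longrightarrow> norm (h j) \<le> 1 / \<delta>"
    "\<And>j k. j \<in> J \<Longrightarrow> k \<in> J \<Longrightarrow> ip (g k) (h j) = (if k = j then 1 else 0)" by metis
  define P where "P x = (\<Sum>b\<in>B. smul (ip x b) b)" for x
  define Q where "Q x = (\<Sum>j\<in>J. smul (ip x (h j)) (g j))" for x
  have Q_id: "Q x = x" if "x \<in> span (g ` J)" for x
    using that
  proof (induction rule: span_induct_alt)
    case base
    show ?case by (simp add: Q_def)
  next
    case (step c x y)
    then obtain k where k: "k \<in> J" "x = g k" by blast
    have "Q (g k) = (\<Sum>j\<in>J. if j = k then g j else 0)"
      unfolding Q_def using k h(3) by (intro sum.cong) auto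
    also have "\<dots> = g k" using J k by simp
    finally have "Q x = x" by (simp add: k)
    then show ?case using step(2)
      by (simp add: Q_def ip_add_left ip_scale_left scale_left_distrib sum.distrib flip: scale_scale scale_sum_right)
  qed
  \<comment> \<open>Since every \<open>h j\<close> lies in \<open>span (g ` J)\<close>, \<open>Q x\<close> is the orthogonal projection of \<open>x\<close> onto this span.\<close>
  have Q_contracts: "norm (Q x) \<le> norm x" for x
  proof -
    have "finite (g ` J)" using J by simp
    from orthogonal_projection_exists[OF this, of x]
    obtain p where p: "p \<in> span (g ` J)" "\<And>y. y \<in> span (g ` J) \<Longrightarrow> ip (x - p) y = 0" by blast
    have "ip x (h j) = ip p (h j)" if "j \<in> J" for j
      using p(2)[OF h(1)[OF that]] by (simp add: ip_diff_left)
    then have "Q x = Q p" by (simp add: Q_def)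
    also have "\<dots> = p" by (rule Q_id[OF p(1)])
    finally have "Q x = p" .
    moreover have "norm p \<le> norm x"
      using norm_le_if_orthogonal[OF ip_eq_zero_commute[OF p(2)[OF p(1)]]] by simp
    ultimately show ?thesis by simp
  qed
  have P_close: "norm (g j - P (g j)) \<le> \<epsilon>" if j: "j \<in> J" for j
  proof -
    from approx[OF j] obtain v where v: "v \<in> span B" "norm (g j - v) \<le> \<epsilon>" unfolding B(4) by blast
    have "P (g j) \<in> span B" unfolding P_def by (intro span_sum span_scale span_base)
    then have "ip (g j - P (g j)) (P (g j) - v) = 0"
      using orthonormal_projection[OF B(1,3)] v(1) by (simp add: P_def span_diff)
    from norm_le_if_orthogonal[OF this] v(2) show ?thesis by simp
  qed
  define t where "t = (\<Sum>j\<in>J. ip (P (g j)) (h j))"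
  have "t = (\<Sum>j\<in>J. \<Sum>b\<in>B. ip (g j) b * ip b (h j))"
    by (simp add: t_def P_def ip_sum_left ip_scale_left)
  also have "\<dots> = (\<Sum>b\<in>B. \<Sum>j\<in>J. ip (g j) b * ip b (h j))" by (rule sum.swap)
  also have "\<dots> = (\<Sum>b\<in>B. ip (Q b) b)"
    by (simp add: Q_def ip_sum_left ip_scale_left mult.commute)
  finally have "norm t \<le> (\<Sum>b\<in>B. norm (ip (Q b) b))" by (simp add: norm_sum)
  also have "\<dots> \<le> (\<Sum>b\<in>B. 1)"
  proof (rule sum_mono)
    fix b assume "b \<in> B"
    with B(3) have "norm b = 1" by (rule orthonormalD_norm)
    then show "norm (ip (Q b) b) \<le> 1"
      using Cauchy_Schwarz[of "Q b" b] Q_contracts[of b] by simp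
  qed
  finally have upper: "norm t \<le> real (card X)" using B(2) by simp
  have "of_nat (card J) - t = (\<Sum>j\<in>J. ip (g j - P (g j)) (h j))"
    unfolding t_def ip_diff_left sum_subtractf using h(3) by simp
  then have "norm (of_nat (card J) - t) \<le> (\<Sum>j\<in>J. norm (ip (g j - P (g j)) (h j)))"
    by (simp add: norm_sum)
  also have "\<dots> \<le> (\<Sum>j\<in>J. \<epsilon> / \<delta>)"
  proof (rule sum_mono)
    fix j assume j: "j \<in> J"
    have "norm (ip (g j - P (g j)) (h j)) \<le> norm (g j - P (g j)) * norm (h j)"
      by (rule Cauchy_Schwarz)
    also have "\<dots> \<le> \<epsilon> * (1 / \<delta>)"
      using P_close[OF j] h(2)[OF j] by (intro mult_mono') auto
    finally show "norm (ip (g j - P (g j)) (h j)) \<le> \<epsilon> / \<delta>" by simp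
  qed
  finally have "norm (of_nat (card J) - t) \<le> \<epsilon> / \<delta> * real (card J)" by (simp add: mult.commute)
  moreover have "norm (of_nat (card J) :: 'k) \<le> norm t + norm (of_nat (card J) - t)"
    by (metis norm_triangle_sub)
  ultimately show ?thesis using upper by (simp add: algebra_simps)
qed

section \<open>Riesz sequences\<close>

text \<open>
Write \<open>g i = T (u i)\<close> with \<open>u\<close> orthonormal. Continuity of the inverse of \<open>T\<close> at \<open>0\<close> makes \<open>T\<close> bounded below,
and \<open>u j\<close> has distance \<open>1\<close> from the span of the other \<open>u i\<close>.
\<close>

lemma riesz_sequence_uniformly_minimal:
  assumes "riesz_sequence smul ip I g"
  shows "\<exists>\<delta>>0. \<forall>j\<in>I. \<forall>w\<in>span (g ` (I - {j})). \<delta> \<le> norm (g j - w)"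
proof -
  define K where "K = closed_span smul (g ` I)"
  from assms obtain u T T' where u: "\<forall>i\<in>I. \<forall>j\<in>I. ip (u i) (u j) = (if i = j then 1 else 0)"
    and K: "closed_span smul (u ` I) = K"
    and T_add: "\<And>x y. x \<in> K \<Longrightarrow> y \<in> K \<Longrightarrow> T (x + y) = T x + T y"
    and T_scale: "\<And>c x. x \<in> K \<Longrightarrow> T (smul c x) = smul c (T x)"
    and hom: "homeomorphism K K T T'" and g: "\<And>i. i \<in> I \<Longrightarrow> g i = T (u i)"
    unfolding riesz_sequence_def riesz_basis_of_def orthonormal_basis_of_def K_def by blast
  have sub: "span (u ` I) \<subseteq> K"
    unfolding K[symmetric] closed_span_def by (rule closure_subset)
  have K0: "0 \<in> K" using sub span_zero by blast
  have T0: "T 0 = 0" using T_add[OF K0 K0] by simp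
  have T'T: "T' (T x) = x" if "x \<in> K" for x using hom that by (rule homeomorphism_apply1)
  have TK: "T x \<in> K" if "x \<in> K" for x using hom that unfolding homeomorphism_def by blast
  have "continuous_on K T'" using hom by (simp add: homeomorphism_def)
  then obtain \<delta> where \<delta>: "\<delta> > 0" "\<And>y. y \<in> K \<Longrightarrow> dist y 0 < \<delta> \<Longrightarrow> dist (T' y) (T' 0) < 1"
    unfolding continuous_on_iff using K0 zero_less_one by blast
  have T'0: "T' 0 = 0" using T'T[OF K0] T0 by simp
  \<comment> \<open>If \<open>norm (T x) < \<delta>\<close> for a unit vector \<open>x\<close>, then \<open>x = T' (T x)\<close> would have norm less than \<open>1\<close>.\<close>
  have bounded_below: "\<delta> * norm x \<le> norm (T x)" if x: "x \<in> span (u ` I)" for x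
  proof (cases "x = 0")
    case False
    define y where "y = smul (of_real (inverse (norm x))) x"
    have y: "y \<in> K" using x sub by (auto simp: y_def intro: span_scale)
    have "T y = smul (of_real (inverse (norm x))) (T x)"
      using x sub T_scale by (auto simp: y_def)
    then have "norm (T y) = norm (T x) / norm x"
      unfolding norm_smul by (simp add: norm_smul divide_inverse mult.commute norm_inverse)
    moreover have "norm y = 1" using False by (simp add: y_def norm_smul norm_inverse)
    moreover have "norm y < 1" if "norm (T y) < \<delta>"
      using \<delta>(2)[OF TK[OF y]] that by (simp add: T'0 T'T[OF y])
    ultimately have "\<delta> \<le> norm (T x) / norm x" by force
    then show ?thesis using False by (simp add: pos_le_divide_eq)
  qed (simp add: T0)
  have "\<delta> \<le> norm (g j - w)" if j: "j \<in> I" and w: "w \<in> span (g ` (I - {j}))" for j w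
  proof -
    have mono: "span (u ` (I - {j})) \<subseteq> span (u ` I)" by (intro span_mono) auto
    from w have "\<exists>z\<in>span (u ` (I - {j})). w = T z"
    proof (induction rule: span_induct_alt)
      case base
      show ?case using T0 span_zero by metis
    next
      case (step c x y)
      then obtain k z where k: "k \<in> I - {j}" "x = T (u k)" and z: "z \<in> span (u ` (I - {j}))" "y = T z"
        using g by auto
      have uk: "u k \<in> span (u ` (I - {j}))" using k by (intro span_base) auto
      have "T (smul c (u k) + z) = smul c x + y"
        using T_add[of "smul c (u k)" z] T_scale[of "u k" c] uk z k mono sub
        by (metis span_scale subsetD)
      then show ?case using uk z by (metis span_add span_scale)
    qed
    then obtain z where z: "z \<in> span (u ` (I - {j}))" "w = T z" by blast
    have zI: "z \<in> span (u ` I)" and uj: "u j \<in> span (u ` I)"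
      using z mono j by (auto intro: span_base)
    have "u j = (u j - z) + z" by simp
    then have "g j = T (u j - z) + T z"
      using g[OF j] T_add[of "u j - z" z] span_diff[OF uj zI] zI sub by auto
    then have gw: "g j - w = T (u j - z)" using z by simp
    have "ip (u j) z = 0"
      using z(1) j u by (intro orthogonal_span[of "u ` (I - {j})" "u j" z]) (auto split: if_splits)
    then have "ip (u j - z) (u j) = 1"
      using u j ip_eq_zero_commute by (simp add: ip_diff_left)
    then have "1 \<le> norm (u j - z) * norm (u j)" using Cauchy_Schwarz[of "u j - z" "u j"] by simp
    moreover have "norm (u j) = 1"
      using u j by (intro orthonormalD_norm[of "{u j}"]) (auto simp: orthonormal_def)
    ultimately have "\<delta> * 1 \<le> \<delta> * norm (u j - z)" using \<delta>(1) by (intro mult_left_mono) auto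
    also have "\<dots> \<le> norm (T (u j - z))" by (intro bounded_below span_diff uj zI)
    finally show ?thesis by (simp add: gw)
  qed
  with \<delta>(1) show ?thesis by blast
qed

lemma ex_span_close_if_infdist_less:
  assumes "infdist x (closed_span smul X) < \<epsilon>"
  shows "\<exists>v\<in>span X. norm (x - v) \<le> \<epsilon>"
proof -
  have "closure (span X) \<noteq> {}" using span_zero closure_subset by blast
  moreover from this have "(INF v\<in>closure (span X). dist x v) < \<epsilon>"
    using assms by (simp add: closed_span_def infdist_def)
  ultimately obtain w where "w \<in> closure (span X)" and w: "dist x w < \<epsilon>"
    by (subst (asm) cINF_less_iff) (auto simp: bdd_below_def intro: exI[of _ 0])
  then obtain v where v: "v \<in> span X" "dist v w < \<epsilon> - dist x w"
    unfolding closure_approachable by (meson diff_gt_0_iff_gt)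
  have "dist x v \<le> dist x w + dist v w" by (rule dist_triangle2)
  with v(2) have "norm (x - v) \<le> \<epsilon>" unfolding dist_norm[symmetric] by linarith
  with v(1) show ?thesis by blast
qed

text \<open>
The form in which the Hilbert space theory enters the density estimates. The approximating set \<open>Y\<close> may depend
on \<open>j\<close>: in the applications it comes from a small box around \<open>j\<close>, and \<open>X\<close> from a large box that contains
all of them.
\<close>

lemma riesz_sequence_card_bound:
  assumes "riesz_sequence smul ip I g" and "\<eta> > 0"
  shows "\<exists>\<epsilon>>0. \<forall>J X. finite J \<longrightarrow> J \<subseteq> I \<longrightarrow> finite X \<longrightarrow>
    (\<forall>j\<in>J. \<exists>Y\<subseteq>X. infdist (g j) (closed_span smul Y) < \<epsilon>) \<longrightarrow>
    (1 - \<eta>) * real (card J) \<le> real (card X)"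
proof -
  from riesz_sequence_uniformly_minimal[OF assms(1)] obtain \<delta> where \<delta>: "\<delta> > 0"
    "\<And>j w. j \<in> I \<Longrightarrow> w \<in> span (g ` (I - {j})) \<Longrightarrow> \<delta> \<le> norm (g j - w)" by blast
  show ?thesis
  proof (intro exI[of _ "\<eta> * \<delta>"] conjI allI impI)
    show "\<eta> * \<delta> > 0" using \<delta> assms by simp
    fix J and X :: "'h set"
    assume J: "finite J" "J \<subseteq> I" and X: "finite X"
      and *: "\<forall>j\<in>J. \<exists>Y\<subseteq>X. infdist (g j) (closed_span smul Y) < \<eta> * \<delta>"
    have "(1 - \<eta> * \<delta> / \<delta>) * real (card J) \<le> real (card X)"
    proof (rule card_le_dimension_of_approximating_span[OF J(1) X \<delta>(1), of g])
      fix j w assume "j \<in> J" "w \<in> span (g ` (J - {j}))"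
      moreover have "span (g ` (J - {j})) \<subseteq> span (g ` (I - {j}))" using J by (intro span_mono) auto
      ultimately show "\<delta> \<le> norm (g j - w)" using J \<delta>(2) by blast
    next
      fix j assume "j \<in> J"
      with * obtain Y where "Y \<subseteq> X" "infdist (g j) (closed_span smul Y) < \<eta> * \<delta>" by blast
      then show "\<exists>v\<in>span X. norm (g j - v) \<le> \<eta> * \<delta>"
        using ex_span_close_if_infdist_less span_mono by blast
    qed
    then show "(1 - \<eta>) * real (card J) \<le> real (card X)" using \<delta> by simp
  qed
qed

end

section \<open>Densities in groups with slowly growing boxes\<close>

text \<open>
A group with a subadditive length whose balls are finite and satisfy the Foelner condition: enlarging the
size parameter by a fixed \<open>M\<close> changes the number of elements by a factor tending to \<open>1\<close>. The condition is
only imposed at the identity, since all balls of equal size are translates of each other.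
\<close>

locale amenable_length = group G for G :: "'g monoid" (structure) +
  fixes \<nu> :: "'g \<Rightarrow> real"
  assumes subadditive: "x \<in> carrier G \<Longrightarrow> y \<in> carrier G \<Longrightarrow> \<nu> (x \<otimes> y) \<le> \<nu> x + \<nu> y"
    and length_one: "\<nu> \<one> = 0"
    and finite_box_one: "finite (lattice_box G \<nu> N \<one>)"
    and growth: "(\<lambda>N. real (card (lattice_box G \<nu> (N + M) \<one>)) / real (card (lattice_box G \<nu> N \<one>))) \<longlonglongrightarrow> 1"
begin

definition box_size :: "nat \<Rightarrow> nat"
  where "box_size N = card (lattice_box G \<nu> N \<one>)"

lemma box_size_pos: "box_size N > 0"
proof -
  have "\<one> \<in> lattice_box G \<nu> N \<one>" by (simp add: lattice_box_def length_one)
  then show ?thesis using finite_box_one card_gt_0_iff unfolding box_size_def by blast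
qed

lemma box_translate:
  assumes "j \<in> carrier G"
  shows "lattice_box G \<nu> N j = (\<lambda>k. k \<otimes> j) ` lattice_box G \<nu> N \<one>"
proof (intro equalityI subsetI)
  fix k assume "k \<in> lattice_box G \<nu> N j"
  then have k: "k \<in> carrier G" "\<nu> (k \<otimes> inv j) \<le> real N / 2" by (auto simp: lattice_box_def)
  then have "k \<otimes> inv j \<in> lattice_box G \<nu> N \<one>" using assms by (simp add: lattice_box_def)
  moreover have "k = (k \<otimes> inv j) \<otimes> j" using k assms by (simp add: m_assoc)
  ultimately show "k \<in> (\<lambda>k. k \<otimes> j) ` lattice_box G \<nu> N \<one>" by blast
next
  fix k assume "k \<in> (\<lambda>k. k \<otimes> j) ` lattice_box G \<nu> N \<one>"
  then obtain l where "l \<in> carrier G" "\<nu> l \<le> real N / 2" "k = l \<otimes> j"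
    unfolding lattice_box_def by auto
  moreover from this have "k \<otimes> inv j = l" using assms by (simp add: m_assoc)
  ultimately show "k \<in> lattice_box G \<nu> N j" using assms by (simp add: lattice_box_def)
qed

lemma finite_box: "j \<in> carrier G \<Longrightarrow> finite (lattice_box G \<nu> N j)"
  by (simp only: box_translate[of j N] finite_box_one finite_imageI)

lemma card_box: "j \<in> carrier G \<Longrightarrow> card (lattice_box G \<nu> N j) = box_size N"
  unfolding box_size_def box_translate[of j N]
  by (intro card_image inj_onI) (auto simp: lattice_box_def)

text \<open>
The parameter of a box is its side length, so the radii \<open>N / 2\<close> and \<open>M / 2\<close> add up to \<open>(N + M) / 2\<close>.
\<close>

lemma box_trans:
  assumes "k \<in> lattice_box G \<nu> M x" "x \<in> lattice_box G \<nu> N j" "j \<in> carrier G"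
  shows "k \<in> lattice_box G \<nu> (N + M) j"
proof -
  have c: "k \<in> carrier G" "x \<in> carrier G" using assms by (auto simp: lattice_box_def)
  have "k \<otimes> inv j = (k \<otimes> inv x) \<otimes> (x \<otimes> inv j)"
    using c assms(3) by (simp add: m_assoc inv_solve_left)
  then have "\<nu> (k \<otimes> inv j) \<le> \<nu> (k \<otimes> inv x) + \<nu> (x \<otimes> inv j)"
    using subadditive[of "k \<otimes> inv x" "x \<otimes> inv j"] c assms(3) by simp
  then show ?thesis using assms c by (auto simp: lattice_box_def add_divide_distrib)
qed

lemma box_size_growth: "(\<lambda>N. real (box_size (N + M)) / real (box_size N)) \<longlonglongrightarrow> 1"
  unfolding box_size_def by (rule growth)

lemma density_quotient:
  assumes "j \<in> carrier G"
  shows "ecard P / ecard (lattice_box G \<nu> N j)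
    = (if finite P then ennreal (real (card P) / real (box_size N)) else \<infinity>)"
proof -
  have "of_nat m / of_nat (box_size N) = ennreal (real m / real (box_size N))" for m
    unfolding ennreal_of_nat_eq_real_of_nat using box_size_pos[of N] by (intro divide_ennreal) auto
  then show ?thesis
    using assms by (simp add: ecard_def finite_box card_box ennreal_top_divide)
qed

text \<open>
The comparison between the box of size \<open>N\<close> and the preimage of the box of size \<open>N + M\<close> is harmless
asymptotically, because \<open>box_size (N + M) / box_size N\<close> tends to \<open>1\<close>, and uniform in the centre \<open>j\<close>, because
the size of a box does not depend on it. An infinite preimage has quotient \<open>\<infinity>\<close>, so that only finite ones need
to be bounded.
\<close>

lemma lower_density_ge_one:
  assumes "\<And>\<eta>. \<eta> > 0 \<Longrightarrow> \<exists>M. \<forall>N. \<forall>j\<in>carrier G. finite (preimage_box G \<nu> I a (N + M) j) \<longrightarrow>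
      (1 - \<eta>) * real (box_size N) \<le> real (card (preimage_box G \<nu> I a (N + M) j))"
  shows "1 \<le> lower_density G \<nu> I a"
  unfolding lower_density_def le_Liminf_iff
proof (intro allI impI)
  fix y :: ennreal assume "y < 1"
  then obtain r where r: "y = ennreal r" "0 \<le> r" "r < 1"
    by (cases y) (auto simp: ennreal_less_iff simp flip: ennreal_1)
  \<comment> \<open>Both the hypothesis and the growth of boxes cost a factor \<open>1 - \<eta>\<close>; with this \<open>\<eta>\<close>, \<open>(1 - \<eta>)\<^sup>2\<close> exceeds \<open>r\<close>.\<close>
  define \<eta> where "\<eta> = (1 - r) / 3"
  have \<eta>: "0 < \<eta>" "\<eta> < 1" and "r < 1 - 2 * \<eta>" using r by (auto simp: \<eta>_def field_simps)
  moreover have "0 < \<eta> * \<eta>" using \<eta> by simp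
  moreover have "(1 - \<eta>) * (1 - \<eta>) = 1 - 2 * \<eta> + \<eta> * \<eta>" by (simp add: algebra_simps)
  ultimately have "r < (1 - \<eta>) * (1 - \<eta>)" by linarith
  from assms[OF \<eta>(1)] obtain M where M: "\<And>N j. j \<in> carrier G \<Longrightarrow> finite (preimage_box G \<nu> I a (N + M) j) \<Longrightarrow>
      (1 - \<eta>) * real (box_size N) \<le> real (card (preimage_box G \<nu> I a (N + M) j))" by blast
  have "1 < 1 / (1 - \<eta>)" using \<eta> by simp
  from order_tendstoD(2)[OF box_size_growth this, of M]
  have "\<forall>\<^sub>F N in sequentially. y < (INF j\<in>carrier G. ecard (preimage_box G \<nu> I a (N + M) j) /
      ecard (lattice_box G \<nu> (N + M) j))"
  proof eventually_elim
    case (elim N)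
    then have N: "(1 - \<eta>) * real (box_size (N + M)) \<le> real (box_size N)"
      using \<eta> box_size_pos[of N] by (simp add: field_simps)
    have "y < ennreal ((1 - \<eta>) * (1 - \<eta>))"
      using \<open>r < (1 - \<eta>) * (1 - \<eta>)\<close> r by (simp add: ennreal_lessI)
    also have "\<dots> \<le> (INF j\<in>carrier G. ecard (preimage_box G \<nu> I a (N + M) j) /
      ecard (lattice_box G \<nu> (N + M) j))"
    proof (rule INF_greatest)
      fix j assume j: "j \<in> carrier G"
      have "(1 - \<eta>) * (1 - \<eta>) \<le> real (card (preimage_box G \<nu> I a (N + M) j)) / real (box_size (N + M))"
        if "finite (preimage_box G \<nu> I a (N + M) j)"
      proof -
        have "(1 - \<eta>) * ((1 - \<eta>) * real (box_size (N + M))) \<le> (1 - \<eta>) * real (box_size N)"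
          using N \<eta> by (intro mult_left_mono) auto
        also have "\<dots> \<le> real (card (preimage_box G \<nu> I a (N + M) j))" by (rule M[OF j that])
        finally show ?thesis using box_size_pos[of "N + M"] by (simp add: pos_le_divide_eq mult.assoc)
      qed
      then show "ennreal ((1 - \<eta>) * (1 - \<eta>)) \<le> ecard (preimage_box G \<nu> I a (N + M) j) /
          ecard (lattice_box G \<nu> (N + M) j)"
        using j by (simp add: density_quotient ennreal_leI)
    qed
    finally show ?case .
  qed
  then show "\<forall>\<^sub>F N in sequentially. y < (INF j\<in>carrier G. ecard (preimage_box G \<nu> I a N j) /
      ecard (lattice_box G \<nu> N j))"
    by (simp only: eventually_sequentially_seg[of "\<lambda>N. y < (INF j\<in>carrier G. ecard (preimage_box G \<nu> I a N j) /
      ecard (lattice_box G \<nu> N j))" M])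
qed

text \<open>
The hypothesis bounds finite subsets of the preimage rather than the preimage itself, since that is what a
dimension count delivers; finiteness of the preimage then follows from the uniform bound.
\<close>

lemma upper_density_le_one:
  assumes "\<And>\<eta>. \<eta> > 0 \<Longrightarrow> \<exists>M. \<forall>N. \<forall>j\<in>carrier G. \<forall>J. finite J \<longrightarrow> J \<subseteq> preimage_box G \<nu> I a N j \<longrightarrow>
      (1 - \<eta>) * real (card J) \<le> real (box_size (N + M))"
  shows "upper_density G \<nu> I a \<le> 1"
  unfolding upper_density_def Limsup_le_iff
proof (intro allI impI)
  fix y :: ennreal assume "1 < y"
  then obtain z where z: "1 < z" "z < y" using dense by blast
  then obtain r where r: "z = ennreal r" "1 < r"
    by (cases z) (auto simp: ennreal_less_iff simp flip: ennreal_1)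
  \<comment> \<open>Chosen so that \<open>r * (1 - \<eta>)\<close> is the midpoint of \<open>1\<close> and \<open>r\<close>, which leaves room for the growth of boxes.\<close>
  define \<eta> where "\<eta> = (r - 1) / (2 * r)"
  have \<eta>: "0 < \<eta>" "\<eta> < 1" and \<eta>_r: "r * (1 - \<eta>) = (r + 1) / 2" using r by (auto simp: \<eta>_def field_simps)
  from assms[OF \<eta>(1)] obtain M where M: "\<forall>N. \<forall>j\<in>carrier G. \<forall>J. finite J \<longrightarrow> J \<subseteq> preimage_box G \<nu> I a N j \<longrightarrow>
      (1 - \<eta>) * real (card J) \<le> real (box_size (N + M))" ..
  have "1 < (r + 1) / 2" using r by simp
  from order_tendstoD(2)[OF box_size_growth this, of M]
  show "\<forall>\<^sub>F N in sequentially. y > (SUP j\<in>carrier G. ecard (preimage_box G \<nu> I a N j) /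
      ecard (lattice_box G \<nu> N j))"
  proof eventually_elim
    case (elim N)
    then have "real (box_size (N + M)) \<le> (r + 1) / 2 * real (box_size N)"
      using box_size_pos[of N] by (simp add: pos_divide_less_eq)
    also have "\<dots> = (1 - \<eta>) * (r * real (box_size N))"
      unfolding \<eta>_r[symmetric] by (simp only: mult_ac)
    finally have N: "real (box_size (N + M)) \<le> (1 - \<eta>) * (r * real (box_size N))" .
    have "(SUP j\<in>carrier G. ecard (preimage_box G \<nu> I a N j) / ecard (lattice_box G \<nu> N j)) \<le> ennreal r"
    proof (rule SUP_least)
      fix j assume j: "j \<in> carrier G"
      have bound: "real (card J) \<le> r * real (box_size N)" if "finite J" "J \<subseteq> preimage_box G \<nu> I a N j" for J
        by (rule mult_left_le_imp_le[OF order_trans[OF M[rule_format, OF j that] N]]) (use \<eta>(2) in simp)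
      have "card J \<le> nat \<lfloor>r * real (box_size N)\<rfloor>" if "finite J" "J \<subseteq> preimage_box G \<nu> I a N j" for J
        by (rule le_nat_floor[OF bound[OF that]])
      then have fin: "finite (preimage_box G \<nu> I a N j)"
        using finite_if_finite_subsets_card_bdd[of "preimage_box G \<nu> I a N j"] by blast
      from bound[OF this order_refl]
      have "real (card (preimage_box G \<nu> I a N j)) / real (box_size N) \<le> r"
        using box_size_pos[of N] by (simp add: pos_divide_le_eq)
      then show "ecard (preimage_box G \<nu> I a N j) / ecard (lattice_box G \<nu> N j) \<le> ennreal r"
        using fin j by (simp add: density_quotient ennreal_leI)
    qed
    then show ?case using z r by simp
  qed
qed

lemma lower_density_le_upper_density: "lower_density G \<nu> I a \<le> upper_density G \<nu> I a"
proof -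
  have ne: "carrier G \<noteq> {}" by blast
  have "lower_density G \<nu> I a \<le> liminf (\<lambda>N. SUP j\<in>carrier G. ecard (preimage_box G \<nu> I a N j) / ecard (lattice_box G \<nu> N j))"
    unfolding lower_density_def by (intro Liminf_mono always_eventually allI INF_le_SUP ne)
  also have "\<dots> \<le> upper_density G \<nu> I a"
    unfolding upper_density_def by (intro Liminf_le_Limsup) simp
  finally show ?thesis .
qed

end

section \<open>Boxes in the index group\<close>

lemma half_box_count_growth:
  fixes \<alpha> :: real assumes "\<alpha> > 0"
  shows "(\<lambda>N::nat. (2 * of_int \<lfloor>real (N + M) / (2 * \<alpha>)\<rfloor> + 1) / (2 * of_int \<lfloor>real N / (2 * \<alpha>)\<rfloor> + 1) :: real) \<longlonglongrightarrow> 1"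
  using assms by real_asymp

lemma index_abs_le_iff:
  assumes "d \<ge> 1"
  shows "index_abs d e (x, m) \<le> r \<longleftrightarrow> (\<forall>i<d. \<bar>x i\<bar> \<le> r) \<and> (\<forall>j<e. (if m j = 0 then 0 else 1) \<le> r)"
proof -
  let ?S = "(\<lambda>i. \<bar>x i\<bar>) ` {..<d} \<union> (\<lambda>j. if m j = 0 then 0 else 1) ` {..<e}"
  have "?S \<noteq> {}" using assms by (auto simp: lessThan_empty_iff)
  then have "Sup ?S \<le> r \<longleftrightarrow> (\<forall>s\<in>?S. s \<le> r)"
    by (intro cSup_le_iff) auto
  then show ?thesis by (auto simp: index_abs_def)
qed

lemma index_abs_nonneg: 
  assumes "d \<ge> 1" shows "0 \<le> index_abs d e g"
proof (cases g)
  case (Pair x m)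
  have "\<bar>x 0\<bar> \<le> index_abs d e g"
    using index_abs_le_iff[OF assms, of e x m "index_abs d e g"] assms by (auto simp: Pair)
  then show ?thesis by linarith
qed

text \<open>
On a cyclic factor this says that a sum of residues vanishes if both summands do.
\<close>

lemma index_abs_subadditive:
  assumes "d \<ge> 1" "g \<in> carrier (index_group d \<alpha> e n)" "h \<in> carrier (index_group d \<alpha> e n)"
  shows "index_abs d e (g \<otimes>\<^bsub>index_group d \<alpha> e n\<^esub> h) \<le> index_abs d e g + index_abs d e h"
proof -
  obtain x m y l where gh: "g = (x, m)" "h = (y, l)" by (cases g, cases h)
  have le: "(\<forall>i<d. \<bar>x i\<bar> \<le> index_abs d e g)" "(\<forall>j<e. (if m j = 0 then 0 else 1) \<le> index_abs d e g)"
     "(\<forall>i<d. \<bar>y i\<bar> \<le> index_abs d e h)" "(\<forall>j<e. (if l j = 0 then 0 else 1) \<le> index_abs d e h)"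
    using index_abs_le_iff[OF assms(1), of e x m "index_abs d e g"]
      index_abs_le_iff[OF assms(1), of e y l "index_abs d e h"] by (auto simp: gh)
  have "index_abs d e ((\<lambda>i\<in>{..<d}. x i + y i), (\<lambda>j\<in>{..<e}. (m j + l j) mod int (n j)))
    \<le> index_abs d e g + index_abs d e h"
    unfolding index_abs_le_iff[OF assms(1)]
  proof (intro conjI allI impI)
    fix i assume "i < d"
    then have "\<bar>x i\<bar> \<le> index_abs d e g" "\<bar>y i\<bar> \<le> index_abs d e h" using le by auto
    then show "\<bar>(\<lambda>i\<in>{..<d}. x i + y i) i\<bar> \<le> index_abs d e g + index_abs d e h"
      using \<open>i < d\<close> by simp
  next
    fix j assume j: "j < e"
    then have "(if m j = 0 then 0 else 1) \<le> index_abs d e g" "(if l j = 0 then 0 else 1) \<le> index_abs d e h"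
      using le by auto
    then show "(if (\<lambda>j\<in>{..<e}. (m j + l j) mod int (n j)) j = 0 then 0 else 1) \<le> index_abs d e g + index_abs d e h"
      using j index_abs_nonneg[OF assms(1), of e g] index_abs_nonneg[OF assms(1), of e h]
      by (auto split: if_splits)
  qed
  then show ?thesis by (simp add: gh index_group_def scaled_integer_group_def)
qed

lemma card_scaled_integers_in_interval:
  assumes "\<alpha> > 0" "r \<ge> 0"
  shows "finite {x \<in> carrier (scaled_integer_group \<alpha>). \<bar>x\<bar> \<le> r}"
    and "real (card {x \<in> carrier (scaled_integer_group \<alpha>). \<bar>x\<bar> \<le> r}) = 2 * of_int \<lfloor>r / \<alpha>\<rfloor> + 1"
proof -
  have iff: "\<bar>\<alpha> * real_of_int k\<bar> \<le> r \<longleftrightarrow> k \<in> {- \<lfloor>r / \<alpha>\<rfloor>..\<lfloor>r / \<alpha>\<rfloor>}" for k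
  proof -
    have "\<bar>\<alpha> * real_of_int k\<bar> \<le> r \<longleftrightarrow> real_of_int \<bar>k\<bar> \<le> r / \<alpha>"
      using assms by (simp add: abs_mult pos_le_divide_eq mult.commute[of \<alpha>])
    also have "\<dots> \<longleftrightarrow> \<bar>k\<bar> \<le> \<lfloor>r / \<alpha>\<rfloor>" by (rule le_floor_iff[symmetric])
    also have "\<dots> \<longleftrightarrow> k \<in> {- \<lfloor>r / \<alpha>\<rfloor>..\<lfloor>r / \<alpha>\<rfloor>}" by (simp only: atLeastAtMost_iff) linarith
    finally show ?thesis .
  qed
  have eq: "{x \<in> carrier (scaled_integer_group \<alpha>). \<bar>x\<bar> \<le> r} = (\<lambda>k. \<alpha> * real_of_int k) ` {- \<lfloor>r / \<alpha>\<rfloor>..\<lfloor>r / \<alpha>\<rfloor>}"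
  proof -
    have "{x \<in> carrier (scaled_integer_group \<alpha>). \<bar>x\<bar> \<le> r} = (\<lambda>k. \<alpha> * real_of_int k) ` {k. \<bar>\<alpha> * real_of_int k\<bar> \<le> r}"
      by (auto simp: scaled_integer_group_def)
    then show ?thesis by (simp only: iff Collect_mem_eq)
  qed
  have "inj_on (\<lambda>k. \<alpha> * real_of_int k) {- \<lfloor>r / \<alpha>\<rfloor>..\<lfloor>r / \<alpha>\<rfloor>}" using assms by (auto intro!: inj_onI)
  moreover have "0 \<le> \<lfloor>r / \<alpha>\<rfloor>" using assms by simp
  ultimately show "finite {x \<in> carrier (scaled_integer_group \<alpha>). \<bar>x\<bar> \<le> r}"
    "real (card {x \<in> carrier (scaled_integer_group \<alpha>). \<bar>x\<bar> \<le> r}) = 2 * of_int \<lfloor>r / \<alpha>\<rfloor> + 1"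
    unfolding eq by (simp_all add: card_image)
qed

text \<open>
A box around the identity is a product of intervals and, from size \<open>2\<close> on, of the full cyclic factors.
So the torsion part cancels in the quotient of two box sizes, and each of the \<open>d\<close> remaining factors tends to \<open>1\<close>.
\<close>

lemma amenable_length_index_group:
  assumes d: "d \<ge> 1" and \<alpha>: "\<forall>i<d. \<alpha> i > 0" and n: "\<forall>j<e. n j \<ge> 1"
  shows "amenable_length (index_group d \<alpha> e n) (index_abs d e)"
proof -
  let ?G = "index_group d \<alpha> e n"
  interpret group ?G by (rule group_index_group)
  define A where "A N i = {x \<in> carrier (scaled_integer_group (\<alpha> i)). \<bar>x\<bar> \<le> real N / 2}" for N i
  define B where "B N j = {m \<in> carrier (integer_mod_group (n j)). (if m = 0 then 0 else 1) \<le> real N / 2}" for N j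
  have box: "lattice_box ?G (index_abs d e) N \<one>\<^bsub>?G\<^esub> = (\<Pi>\<^sub>E i\<in>{..<d}. A N i) \<times> (\<Pi>\<^sub>E j\<in>{..<e}. B N j)" for N
  proof -
    have "lattice_box ?G (index_abs d e) N \<one>\<^bsub>?G\<^esub> = {k \<in> carrier ?G. index_abs d e k \<le> real N / 2}"
      by (auto simp: lattice_box_def)
    also have "\<dots> = (\<Pi>\<^sub>E i\<in>{..<d}. A N i) \<times> (\<Pi>\<^sub>E j\<in>{..<e}. B N j)"
    proof (rule Set.set_eqI)
      fix k :: index
      obtain x m where k: "k = (x, m)" by (cases k)
      show "k \<in> {k \<in> carrier ?G. index_abs d e k \<le> real N / 2} \<longleftrightarrow>
          k \<in> (\<Pi>\<^sub>E i\<in>{..<d}. A N i) \<times> (\<Pi>\<^sub>E j\<in>{..<e}. B N j)"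
        unfolding k mem_Collect_eq index_abs_le_iff[OF d] index_group_def carrier_DirProd carrier_product_group
          mem_Sigma_iff PiE_iff A_def B_def Ball_def lessThan_iff by blast
    qed
    finally show ?thesis .
  qed
  have finB: "finite (B N j)" if "j < e" for N j
    using n that by (intro finite_subset[of "B N j" "{0..<int (n j)}"]) (auto simp: B_def carrier_integer_mod_group split: if_splits)
  have finA: "finite (A N i)" and cardA: "real (card (A N i)) = 2 * of_int \<lfloor>real N / (2 * \<alpha> i)\<rfloor> + 1" if "i < d" for N i
    using card_scaled_integers_in_interval[of "\<alpha> i" "real N / 2"] \<alpha> that by (auto simp: A_def)
  have cardB: "card (B N j) = n j" if "j < e" "N \<ge> 2" for N j
  proof -
    have "B N j = {0..<int (n j)}" using n that by (auto simp: B_def carrier_integer_mod_group)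
    then show ?thesis by simp
  qed
  have card_box: "real (card (lattice_box ?G (index_abs d e) N \<one>\<^bsub>?G\<^esub>)) = (\<Prod>i<d. real (card (A N i))) * (\<Prod>j<e. real (n j))"
    if "N \<ge> 2" for N
    using that by (simp add: box card_cartesian_product card_PiE cardB)
  have n0: "(\<Prod>j<e. real (n j)) \<noteq> 0" using n by (auto simp: prod_zero_iff)
  show ?thesis
  proof unfold_locales
    fix N
    show "finite (lattice_box ?G (index_abs d e) N \<one>\<^bsub>?G\<^esub>)"
      unfolding box using finA finB by (intro finite_cartesian_product finite_PiE) auto
  next
    fix M
    have "(\<lambda>N. \<Prod>i<d. real (card (A (N + M) i)) / real (card (A N i))) \<longlonglongrightarrow> (\<Prod>i<d. 1)"
      using half_box_count_growth[of "\<alpha> i" M for i] \<alpha> by (intro tendsto_prod) (simp add: cardA)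
    moreover have "\<forall>\<^sub>F N in sequentially. (\<Prod>i<d. real (card (A (N + M) i)) / real (card (A N i))) =
        real (card (lattice_box ?G (index_abs d e) (N + M) \<one>\<^bsub>?G\<^esub>)) / real (card (lattice_box ?G (index_abs d e) N \<one>\<^bsub>?G\<^esub>))"
      using eventually_ge_at_top[of 2]
      by eventually_elim (use n0 in \<open>simp add: card_box prod_dividef\<close>)
    ultimately show "(\<lambda>N. real (card (lattice_box ?G (index_abs d e) (N + M) \<one>\<^bsub>?G\<^esub>)) /
        real (card (lattice_box ?G (index_abs d e) N \<one>\<^bsub>?G\<^esub>))) \<longlonglongrightarrow> 1"
      by (simp add: tendsto_cong)
  next
    have "index_abs d e \<one>\<^bsub>?G\<^esub> \<le> 0"
      unfolding index_group_def one_DirProd index_abs_le_iff[OF d]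
      by (auto simp: scaled_integer_group_def)
    then show "index_abs d e \<one>\<^bsub>?G\<^esub> = 0" using index_abs_nonneg[OF d] by (simp add: antisym)
  qed (rule index_abs_subadditive[OF d])
qed

section \<open>Density of frames and Riesz sequences\<close>

theorem theorem3p2:
  fixes smul :: "'k::real_or_complex \<Rightarrow> 'h::banach \<Rightarrow> 'h"
    and ip :: "'h \<Rightarrow> 'h \<Rightarrow> 'k"
    and d e :: nat and \<alpha> :: "nat \<Rightarrow> real" and n :: "nat \<Rightarrow> nat"
    and G :: "index monoid" and \<nu> :: "index \<Rightarrow> real"
    and I :: "'i set" and F :: "'i \<Rightarrow> 'h" and E :: "index \<Rightarrow> 'h" and a :: "'i \<Rightarrow> index"
  assumes "separable_hilbert_space smul ip"
    and "d \<ge> 1" and "\<forall>i<d. \<alpha> i > 0" and "\<forall>j<e. n j \<ge> 1"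
    and "G = index_group d \<alpha> e n" and "\<nu> = index_abs d e"
    and "countable I" and "a \<in> I \<rightarrow> carrier G"
  shows "(is_frame ip I F \<and> riesz_sequence smul ip (carrier G) E \<and> weak_HAP smul ip G \<nu> I F a E
            \<longrightarrow> 1 \<le> lower_density G \<nu> I a \<and> lower_density G \<nu> I a \<le> upper_density G \<nu> I a
                \<and> upper_density G \<nu> I a \<le> \<infinity>)
       \<and> (riesz_sequence smul ip I F \<and> is_frame ip (carrier G) E \<and> weak_dual_HAP smul ip G \<nu> I F a E
            \<longrightarrow> 0 \<le> lower_density G \<nu> I a \<and> lower_density G \<nu> I a \<le> upper_density G \<nu> I a
                \<and> upper_density G \<nu> I a \<le> 1)"
proof (intro conjI impI; (elim conjE)?)
  interpret hilbert: separable_hilbert_space smul ip by (rule assms(1))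
  interpret amenable_length G \<nu>
    unfolding \<open>G = index_group d \<alpha> e n\<close> \<open>\<nu> = index_abs d e\<close>
    by (rule amenable_length_index_group[OF assms(2-4)])
  let ?box = "lattice_box G \<nu>" and ?pre = "preimage_box G \<nu> I a"
  show "lower_density G \<nu> I a \<le> upper_density G \<nu> I a" "lower_density G \<nu> I a \<le> upper_density G \<nu> I a"
    by (rule lower_density_le_upper_density)+
  {
    assume riesz: "riesz_sequence smul ip (carrier G) E" and HAP: "weak_HAP smul ip G \<nu> I F a E"
    let ?dual = "canonical_dual smul ip I F"
    show "1 \<le> lower_density G \<nu> I a"
    proof (rule lower_density_ge_one)
      fix \<eta> :: real assume "\<eta> > 0"
      from hilbert.riesz_sequence_card_bound[OF riesz this] obtain \<epsilon> where "\<epsilon> > 0" and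
        count: "\<forall>J X. finite J \<longrightarrow> J \<subseteq> carrier G \<longrightarrow> finite X \<longrightarrow>
          (\<forall>j\<in>J. \<exists>Y\<subseteq>X. infdist (E j) (closed_span smul Y) < \<epsilon>) \<longrightarrow>
          (1 - \<eta>) * real (card J) \<le> real (card X)"
        by (elim exE conjE)
      from HAP \<open>\<epsilon> > 0\<close> obtain M where
        M: "\<forall>k\<in>carrier G. infdist (E k) (closed_span smul (?dual ` ?pre M k)) < \<epsilon>"
        unfolding weak_HAP_def by blast
      show "\<exists>M. \<forall>N. \<forall>j\<in>carrier G. finite (?pre (N + M) j) \<longrightarrow>
          (1 - \<eta>) * real (box_size N) \<le> real (card (?pre (N + M) j))"
      proof (intro exI[of _ M] allI ballI impI)
        fix N j assume j: "j \<in> carrier G" and fin: "finite (?pre (N + M) j)"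
        have "\<exists>Y\<subseteq>?dual ` ?pre (N + M) j. infdist (E k) (closed_span smul Y) < \<epsilon>" if k: "k \<in> ?box N j" for k
        proof (intro exI conjI)
          show "?dual ` ?pre M k \<subseteq> ?dual ` ?pre (N + M) j"
            unfolding preimage_box_def using box_trans[OF _ k j] by blast
          show "infdist (E k) (closed_span smul (?dual ` ?pre M k)) < \<epsilon>"
            using M k by (simp add: lattice_box_def)
        qed
        moreover have "?box N j \<subseteq> carrier G" by (auto simp: lattice_box_def)
        ultimately have "(1 - \<eta>) * real (card (?box N j)) \<le> real (card (?dual ` ?pre (N + M) j))"
          using count[rule_format, of "?box N j" "?dual ` ?pre (N + M) j"] finite_box[OF j] fin by simp
        also have "\<dots> \<le> real (card (?pre (N + M) j))" using card_image_le[OF fin] by simp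
        finally show "(1 - \<eta>) * real (box_size N) \<le> real (card (?pre (N + M) j))"
          by (simp add: card_box[OF j])
      qed
    qed
  }
  {
    assume riesz: "riesz_sequence smul ip I F" and HAP: "weak_dual_HAP smul ip G \<nu> I F a E"
    let ?dual = "canonical_dual smul ip (carrier G) E"
    show "upper_density G \<nu> I a \<le> 1"
    proof (rule upper_density_le_one)
      fix \<eta> :: real assume "\<eta> > 0"
      from hilbert.riesz_sequence_card_bound[OF riesz this] obtain \<epsilon> where "\<epsilon> > 0" and
        count: "\<forall>J X. finite J \<longrightarrow> J \<subseteq> I \<longrightarrow> finite X \<longrightarrow>
          (\<forall>j\<in>J. \<exists>Y\<subseteq>X. infdist (F j) (closed_span smul Y) < \<epsilon>) \<longrightarrow>
          (1 - \<eta>) * real (card J) \<le> real (card X)"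
        by (elim exE conjE)
      from HAP \<open>\<epsilon> > 0\<close> obtain M where
        M: "\<forall>i\<in>I. infdist (F i) (closed_span smul (?dual ` ?box M (a i))) < \<epsilon>"
        unfolding weak_dual_HAP_def by blast
      show "\<exists>M. \<forall>N. \<forall>j\<in>carrier G. \<forall>J. finite J \<longrightarrow> J \<subseteq> ?pre N j \<longrightarrow>
          (1 - \<eta>) * real (card J) \<le> real (box_size (N + M))"
      proof (intro exI[of _ M] allI ballI impI)
        fix N j J assume j: "j \<in> carrier G" and J: "finite J" "J \<subseteq> ?pre N j"
        have "\<exists>Y\<subseteq>?dual ` ?box (N + M) j. infdist (F i) (closed_span smul Y) < \<epsilon>" if "i \<in> J" for i
        proof (intro exI conjI)
          have i: "i \<in> I" "a i \<in> ?box N j" using that J(2) by (auto simp: preimage_box_def)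
          show "?dual ` ?box M (a i) \<subseteq> ?dual ` ?box (N + M) j"
            using box_trans[OF _ i(2) j] by blast
          show "infdist (F i) (closed_span smul (?dual ` ?box M (a i))) < \<epsilon>"
            using M i(1) by blast
        qed
        moreover have "J \<subseteq> I" using J(2) by (auto simp: preimage_box_def)
        ultimately have "(1 - \<eta>) * real (card J) \<le> real (card (?dual ` ?box (N + M) j))"
          using count[rule_format, of J "?dual ` ?box (N + M) j"] J(1) finite_box[OF j] by simp
        also have "\<dots> \<le> real (box_size (N + M))"
          using card_image_le[OF finite_box[OF j], of ?dual "N + M"] by (simp add: card_box[OF j])
        finally show "(1 - \<eta>) * real (card J) \<le> real (box_size (N + M))" .
      qed
    qed
  }
qed simp_all

end
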